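(* Let $p,q,r>1$ be real numbers satisfying $\frac1p+\frac1q=1+\frac1r$. If $g\in L_p(\mathbb{R})$ and $f\in L_q(\mathbb{R})$, then the convolution $f\underset{H_1,F}{*}g$ is well-defined and belongs to $L_r(\mathbb{R})$. Moreover, $$\big\| f\underset{H_1,F}{*} g\big\|_{L_r(\mathbb{R})} \leq \sqrt{\frac{2}{\pi}}\, \|g\|_{L_p(\mathbb{R})} \|f\|_{L_q(\mathbb{R})}.$$
   Context: The Hartley-Fourier generalized convolution of $f$ and $g$ is $$\big(f\underset{H_1,F}{*}g\big)(x):=\frac{1}{2\sqrt{2\pi}}\int_{\mathbb{R}} g(y)\,[f(x+y)+f(x-y)+i\,f(-x-y)-i\,f(-x+y)]\,dy,\quad x\in\mathbb{R}.$$ $L_p(\mathbb{R})$ denotes the usual Lebesgue space with $\|f\|_{L_p(\mathbb{R})}=\big(\int_{\mathbb{R}}|f(x)|^p dx\big)^{1/p}$. *)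

theory Defs
  imports "HOL-Analysis.Analysis"
begin

text \<open>
  The spaces consist of complex-valued functions on the real line rather than of classes modulo
  equality almost everywhere; measurability is with respect to the completed Lebesgue measure.
\<close>

definition Lp_space :: "real \<Rightarrow> (real \<Rightarrow> complex) set" where
  "Lp_space p =
     {f. f \<in> borel_measurable lebesgue \<and> integrable lebesgue (\<lambda>x. norm (f x) powr p)}"

definition Lp_norm :: "real \<Rightarrow> (real \<Rightarrow> complex) \<Rightarrow> real" where
  "Lp_norm p f = (LINT x|lebesgue. norm (f x) powr p) powr (1 / p)"

definition hf_integrand ::
  "(real \<Rightarrow> complex) \<Rightarrow> (real \<Rightarrow> complex) \<Rightarrow> real \<Rightarrow> real \<Rightarrow> complex" where
  "hf_integrand f g x y =
     g y * (f (x + y) + f (x - y) + \<i> * f (- x - y) - \<i> * f (- x + y))"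

text \<open>
  The Bochner integral of a non-integrable function is 0, so the definition below is meaningful only
  at those \<open>x\<close> for which \<open>hf_integrand f g x\<close> is integrable; existence of the convolution has to be
  claimed separately, by \<open>hf_conv_exists\<close>.
\<close>

definition hf_conv :: "(real \<Rightarrow> complex) \<Rightarrow> (real \<Rightarrow> complex) \<Rightarrow> real \<Rightarrow> complex" where
  "hf_conv f g x =
     complex_of_real (1 / (2 * sqrt (2 * pi))) * (LINT y|lebesgue. hf_integrand f g x y)"

definition hf_conv_exists :: "(real \<Rightarrow> complex) \<Rightarrow> (real \<Rightarrow> complex) \<Rightarrow> bool" where
  "hf_conv_exists f g \<longleftrightarrow> (AE x in lebesgue. integrable lebesgue (hf_integrand f g x))"

end

theory Submission
  imports Defs
begin

text \<open>
  The estimate is Young's convolution inequality, applied once to the sum of the four shifted and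
  reflected copies of \<open>f\<close> rather than to each copy. Put
  \<open>K x y = \<bar>f (x + y)\<bar> + \<bar>f (x - y)\<bar> + \<bar>f (- x - y)\<bar> + \<bar>f (- x + y)\<bar>\<close>, so that
  \<open>\<bar>hf_integrand f g x y\<bar> \<le> K x y * \<bar>g y\<bar>\<close>. All that Young's inequality needs from \<open>K\<close> is that
  the integrals of \<open>K powr q\<close> over rows and over columns have a common bound \<open>B\<close>; it then gives
  \<open>(\<integral> (\<integral> K x y * \<bar>g y\<bar> dy) powr r dx) powr (1 / r) \<le> B powr (1 / q) * Lp_norm p g\<close>
  (\<open>Young_kernel\<close>). Convexity of \<open>t powr q\<close> and the invariance of Lebesgue measure under translation
  and reflection give \<open>B = (4 * Lp_norm q f) powr q\<close> (\<open>hf_kernel_powr_section\<close>). The prefactor of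
  the convolution turns the resulting constant 4 into \<open>4 / (2 * sqrt (2 * pi)) = sqrt (2 / pi)\<close>.

  The kernel inequality follows from the factorization
  \<open>K * h = (K powr q * h powr p) powr (1/r) * (K powr q) powr (1/q - 1/r) * (h powr p) powr (1/p - 1/r)\<close>,
  whose three outer exponents add up to 1. Hoelder's inequality in \<open>y\<close> with three factors
  (\<open>Hoelder3\<close>) bounds the last two factors independently of \<open>x\<close>, and the first one is integrated
  over \<open>x\<close> by Tonelli.

  Tonelli needs joint measurability in \<open>(x, y)\<close>, and for a function \<open>f\<close> that is merely
  Lebesgue measurable \<open>f (x + y)\<close> need not be measurable for the product algebra. Hence the
  inequality is proved for Borel functions, and \<open>f\<close> and \<open>g\<close> are replaced by Borel functions equal
  to them almost everywhere. This leaves the integral defining the convolution unchanged at every \<open>x\<close>, since the affine maps \<open>y \<mapsto> \<plusminus>x \<plusminus> y\<close> pull null sets back to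
  null sets (\<open>hf_integrand_AE_cong\<close>).
\<close>

section \<open>Hoelder's inequality with three factors\<close>

lemma weighted_am_gm3:
  fixes a b c x y z :: real
  assumes "a > 0" "b > 0" "c > 0" "a + b + c = 1" "x \<ge> 0" "y \<ge> 0" "z \<ge> 0"
  shows "x powr a * y powr b * z powr c \<le> a * x + b * y + c * z"
proof (cases "x = 0 \<or> y = 0 \<or> z = 0")
  case True
  then show ?thesis using assms by auto
next
  case False
  then have pos: "x > 0" "y > 0" "z > 0" using assms by auto
  \<comment> \<open>The two-term inequality is used twice, with the last two factors grouped into one weighted mean.\<close>
  define w where "w = y powr (b / (b + c)) * z powr (c / (b + c))"
  have w: "w > 0" using pos by (simp add: w_def)
  have w_le: "w \<le> b / (b + c) * y + c / (b + c) * z"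
    unfolding w_def using assms pos
    by (intro Youngs_inequality_0) (auto simp: add_divide_distrib[symmetric])
  have "w powr (b + c) = y powr b * z powr c"
    using assms pos by (simp add: w_def powr_mult powr_powr)
  then have "x powr a * y powr b * z powr c = x powr a * w powr (b + c)"
    by simp
  also have "\<dots> \<le> a * x + (b + c) * w"
    using assms pos w by (intro Youngs_inequality_0) auto
  also have "\<dots> \<le> a * x + (b + c) * (b / (b + c) * y + c / (b + c) * z)"
    using assms w_le by (intro add_left_mono mult_left_mono) auto
  also have "\<dots> = a * x + b * y + c * z"
    using assms by (simp add: distrib_left add.assoc)
  finally show ?thesis .
qed

text \<open>
  As in the case of two factors, the functions are normalized to have integral 1, and the pointwise
  weighted inequality between the geometric and the arithmetic mean is integrated. If one of the
  integrals vanishes, then so does the product almost everywhere.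
\<close>

lemma Hoelder3:
  fixes u v w :: "'a \<Rightarrow> real"
  assumes abc: "a > 0" "b > 0" "c > 0" "a + b + c = 1"
    and int: "integrable M u" "integrable M v" "integrable M w"
    and nonneg: "\<And>x. u x \<ge> 0" "\<And>x. v x \<ge> 0" "\<And>x. w x \<ge> 0"
  defines "h \<equiv> \<lambda>x. u x powr a * v x powr b * w x powr c"
  defines "C \<equiv> (LINT x|M. u x) powr a * (LINT x|M. v x) powr b * (LINT x|M. w x) powr c"
  shows "integrable M h" and "(LINT x|M. h x) \<le> C"
proof -
  define U V W where "U = (LINT x|M. u x)" "V = (LINT x|M. v x)" "W = (LINT x|M. w x)"
  note [measurable] = borel_measurable_integrable[OF int(1)]
    borel_measurable_integrable[OF int(2)] borel_measurable_integrable[OF int(3)]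
  have UVW: "U \<ge> 0" "V \<ge> 0" "W \<ge> 0"
    using nonneg by (auto simp: U_V_W_def)
  have h_meas: "h \<in> borel_measurable M"
    unfolding h_def by measurable
  have "integrable M h \<and> (LINT x|M. h x) \<le> C"
  proof (cases "U = 0 \<or> V = 0 \<or> W = 0")
    case True
    have "AE x in M. h x = 0"
      using True unfolding U_V_W_def
    proof (elim disjE)
      assume "(LINT x|M. u x) = 0"
      then have "AE x in M. u x = 0"
        using integral_nonneg_eq_0_iff_AE[OF int(1)] nonneg by simp
      then show ?thesis by (auto simp: h_def)
    next
      assume "(LINT x|M. v x) = 0"
      then have "AE x in M. v x = 0"
        using integral_nonneg_eq_0_iff_AE[OF int(2)] nonneg by simp
      then show ?thesis by (auto simp: h_def)
    next
      assume "(LINT x|M. w x) = 0"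
      then have "AE x in M. w x = 0"
        using integral_nonneg_eq_0_iff_AE[OF int(3)] nonneg by simp
      then show ?thesis by (auto simp: h_def)
    qed
    then have "integrable M h" "(LINT x|M. h x) = 0"
      using h_meas integrable_cong_AE[of h M "\<lambda>_. 0"] by (auto intro: integral_eq_zero_AE)
    then show ?thesis by (simp add: C_def)
  next
    case False
    then have pos: "U > 0" "V > 0" "W > 0" using UVW by auto
    then have C_pos: "C > 0" by (simp add: C_def U_V_W_def)
    define k where "k x = C * (a * (u x / U) + b * (v x / V) + c * (w x / W))" for x
    have k_int: "integrable M k"
      unfolding k_def using int by auto
    have h_le: "h x \<le> k x" for x
    proof -
      have "h x = C * ((u x / U) powr a * (v x / V) powr b * (w x / W) powr c)"
        using pos nonneg unfolding h_def C_def U_V_W_def[symmetric] by (simp add: powr_divide)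
      also have "\<dots> \<le> k x"
        unfolding k_def using abc nonneg pos C_pos
        by (intro mult_left_mono weighted_am_gm3) auto
      finally show ?thesis .
    qed
    have h_nonneg: "h x \<ge> 0" for x by (simp add: h_def)
    have h_int: "integrable M h"
      by (rule Bochner_Integration.integrable_bound[OF k_int h_meas])
         (use h_le h_nonneg in \<open>auto intro!: AE_I2 intro: order_trans[OF _ abs_ge_self]\<close>)
    have "(LINT x|M. h x) \<le> (LINT x|M. k x)"
      using h_le by (intro integral_mono h_int k_int)
    also have "\<dots> = C * (a * (U / U) + b * (V / V) + c * (W / W))"
      unfolding k_def using int by (simp add: U_V_W_def)
    also have "\<dots> = C" using pos abc by simp
    finally show ?thesis using h_int by simp
  qed
  then show "integrable M h" "(LINT x|M. h x) \<le> C" by auto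
qed

section \<open>Young's inequality for integral kernels\<close>

lemma (in pair_sigma_finite) integrable_pair_of_sections:
  fixes k :: "'a \<Rightarrow> 'b \<Rightarrow> real" and h :: "'b \<Rightarrow> real"
  assumes meas: "case_prod k \<in> borel_measurable (M1 \<Otimes>\<^sub>M M2)"
    and k_nonneg: "\<And>x y. k x y \<ge> 0" and h_nonneg: "\<And>y. h y \<ge> 0"
    and k_int: "\<And>y. integrable M1 (\<lambda>x. k x y)" and k_le: "\<And>y. (LINT x|M1. k x y) \<le> B"
    and h_int: "integrable M2 h"
  shows "integrable (M1 \<Otimes>\<^sub>M M2) (\<lambda>(x, y). k x y * h y)"
    and "(LINT y|M2. LINT x|M1. k x y * h y) \<le> B * (LINT y|M2. h y)"
proof -
  note [measurable] = meas borel_measurable_integrable[OF h_int]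
  have B: "B \<ge> 0"
    using order_trans[OF Bochner_Integration.integral_nonneg k_le] k_nonneg by blast
  have "(\<integral>\<^sup>+z. ennreal (k (fst z) (snd z) * h (snd z)) \<partial>(M1 \<Otimes>\<^sub>M M2))
      = (\<integral>\<^sup>+y. \<integral>\<^sup>+x. ennreal (k x y * h y) \<partial>M1 \<partial>M2)"
    by (subst nn_integral_snd[symmetric]) auto
  also have "\<dots> \<le> (\<integral>\<^sup>+y. ennreal (B * h y) \<partial>M2)"
  proof (intro nn_integral_mono)
    fix y
    have "(\<integral>\<^sup>+x. ennreal (k x y * h y) \<partial>M1) = ennreal (LINT x|M1. k x y * h y)"
      using k_int k_nonneg h_nonneg by (intro nn_integral_eq_integral) auto
    also have "\<dots> \<le> ennreal (B * h y)"
      using k_le h_nonneg by (auto intro!: ennreal_leI mult_right_mono)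
    finally show "(\<integral>\<^sup>+x. ennreal (k x y * h y) \<partial>M1) \<le> ennreal (B * h y)" .
  qed
  also have "\<dots> = ennreal (LINT y|M2. B * h y)"
    using h_int B h_nonneg by (intro nn_integral_eq_integral) auto
  also have "\<dots> < \<infinity>" by simp
  finally show int: "integrable (M1 \<Otimes>\<^sub>M M2) (\<lambda>(x, y). k x y * h y)"
    using k_nonneg h_nonneg by (intro integrableI_nonneg) (auto simp: split_beta')
  have "(LINT y|M2. LINT x|M1. k x y * h y) \<le> (LINT y|M2. B * h y)"
    using integrable_snd[OF int] h_int k_le h_nonneg
    by (intro integral_mono) (auto intro!: mult_right_mono)
  then show "(LINT y|M2. LINT x|M1. k x y * h y) \<le> B * (LINT y|M2. h y)" by simp
qed

text \<open>
  Young's inequality with translation invariance replaced by its only consequence that matters,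
  a common bound \<open>B\<close> for the \<open>q\<close>-th power integrals of all rows and columns. In this form it
  applies to a sum of translates and reflections of one function as a single kernel.
\<close>

lemma (in pair_sigma_finite) Young_kernel:
  fixes K :: "'a \<Rightarrow> 'b \<Rightarrow> real" and h :: "'b \<Rightarrow> real"
  assumes p: "p > 1" and q: "q > 1" and r: "r > 1" and pqr: "1 / p + 1 / q = 1 + 1 / r"
    and K_meas: "case_prod K \<in> borel_measurable (M1 \<Otimes>\<^sub>M M2)"
    and h_meas: "h \<in> borel_measurable M2"
    and K_nonneg: "\<And>x y. K x y \<ge> 0" and h_nonneg: "\<And>y. h y \<ge> 0"
    and K_rows: "\<And>x. integrable M2 (\<lambda>y. K x y powr q)"
    and rows_le: "\<And>x. (LINT y|M2. K x y powr q) \<le> B"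
    and K_cols: "\<And>y. integrable M1 (\<lambda>x. K x y powr q)"
    and cols_le: "\<And>y. (LINT x|M1. K x y powr q) \<le> B"
    and h_int: "integrable M2 (\<lambda>y. h y powr p)"
  shows "AE x in M1. integrable M2 (\<lambda>y. K x y * h y)"
    and "integrable M1 (\<lambda>x. (LINT y|M2. K x y * h y) powr r)"
    and "(LINT x|M1. (LINT y|M2. K x y * h y) powr r)
          \<le> B powr (r / q) * (LINT y|M2. h y powr p) powr (r / p)"
proof -
  note [measurable] = K_meas h_meas
  define H where "H = (LINT y|M2. h y powr p)"
  define a b c where "a = 1 / r" "b = 1 / q - 1 / r" "c = 1 / p - 1 / r"
  have abc: "a > 0" "b > 0" "c > 0" "a + b + c = 1"
  proof -
    have "1 / p < 1" "1 / q < 1" using p q by auto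
    then show "a > 0" "b > 0" "c > 0" "a + b + c = 1"
      using r pqr unfolding a_b_c_def by auto
  qed
  have H: "H \<ge> 0" by (simp add: H_def)
  have B: "B \<ge> 0"
    using order_trans[OF Bochner_Integration.integral_nonneg rows_le] by simp
  define \<Phi> where "\<Phi> x = (LINT y|M2. K x y powr q * h y powr p)" for x
  have \<Phi>_nonneg: "\<Phi> x \<ge> 0" for x by (simp add: \<Phi>_def)
  have pair_int: "integrable (M1 \<Otimes>\<^sub>M M2) (\<lambda>(x, y). K x y powr q * h y powr p)"
    and swap_le: "(LINT y|M2. LINT x|M1. K x y powr q * h y powr p) \<le> B * H"
    using integrable_pair_of_sections[of "\<lambda>x y. K x y powr q" "\<lambda>y. h y powr p" B]
      K_cols cols_le h_int by (simp_all add: H_def)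
  have \<Phi>_int: "integrable M1 \<Phi>"
    unfolding \<Phi>_def by (rule integrable_fst[OF pair_int])
  have \<Phi>_le: "(LINT x|M1. \<Phi> x) \<le> B * H"
    using Fubini_integral[OF pair_int] swap_le by (simp add: \<Phi>_def)

  \<comment> \<open>The exponents of \<open>K\<close> and of \<open>h\<close> add up to 1 because \<open>1 = q * (1/r) + q * (1/q - 1/r)\<close>, likewise for \<open>p\<close>.\<close>
  have split: "K x y * h y = (K x y powr q * h y powr p) powr a
                 * (K x y powr q) powr b * (h y powr p) powr c" for x y
  proof -
    have "q * a + q * b = 1" "p * a + p * c = 1"
      using p q r by (auto simp: a_b_c_def field_simps)
    then have "K x y * h y = K x y powr (q * a + q * b) * h y powr (p * a + p * c)"
      using K_nonneg[of x y] h_nonneg[of y] by simp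
    also have "\<dots> = (K x y powr q * h y powr p) powr a * (K x y powr q) powr b * (h y powr p) powr c"
      by (simp add: powr_add powr_mult powr_powr)
    finally show ?thesis .
  qed
  have row: "integrable M2 (\<lambda>y. K x y * h y) \<and>
      (LINT y|M2. K x y * h y) powr r \<le> \<Phi> x * (B powr (r * b) * H powr (r * c))"
    if "integrable M2 (\<lambda>y. K x y powr q * h y powr p)" for x
  proof -
    note hoelder = Hoelder3[OF abc that K_rows[of x] h_int, folded split]
    have "(LINT y|M2. K x y * h y)
        \<le> \<Phi> x powr a * (LINT y|M2. K x y powr q) powr b * H powr c"
      using hoelder(2) by (simp add: \<Phi>_def H_def)
    also have "\<dots> \<le> \<Phi> x powr a * B powr b * H powr c"
      using abc rows_le by (intro mult_right_mono mult_left_mono powr_mono2) auto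
    finally have "(LINT y|M2. K x y * h y) powr r \<le> (\<Phi> x powr a * B powr b * H powr c) powr r"
      using r K_nonneg h_nonneg by (intro powr_mono2) auto
    also have "\<dots> = \<Phi> x * (B powr (r * b) * H powr (r * c))"
      using r \<Phi>_nonneg by (simp add: powr_mult powr_powr a_b_c_def mult_ac)
    finally show ?thesis using hoelder(1) by simp
  qed
  have AE_row: "AE x in M1. integrable M2 (\<lambda>y. K x y * h y) \<and>
      (LINT y|M2. K x y * h y) powr r \<le> \<Phi> x * (B powr (r * b) * H powr (r * c))"
    using AE_integrable_fst[OF pair_int] by eventually_elim (rule row)
  then show "AE x in M1. integrable M2 (\<lambda>y. K x y * h y)" by auto
  have bound_int: "integrable M1 (\<lambda>x. \<Phi> x * (B powr (r * b) * H powr (r * c)))"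
    using \<Phi>_int by simp
  show int: "integrable M1 (\<lambda>x. (LINT y|M2. K x y * h y) powr r)"
    by (rule Bochner_Integration.integrable_bound[OF bound_int])
       (use AE_row \<Phi>_nonneg in auto)
  have "(LINT x|M1. (LINT y|M2. K x y * h y) powr r)
      \<le> (LINT x|M1. \<Phi> x * (B powr (r * b) * H powr (r * c)))"
    using AE_row by (intro integral_mono_AE int bound_int) auto
  also have "\<dots> = (LINT x|M1. \<Phi> x) * (B powr (r * b) * H powr (r * c))"
    by simp
  also have "\<dots> \<le> B * H * (B powr (r * b) * H powr (r * c))"
    using \<Phi>_le by (intro mult_right_mono) auto
  also have "\<dots> = B powr (r / q) * H powr (r / p)"
  proof -
    \<comment> \<open>One factor \<open>B\<close> comes from Tonelli, the power \<open>r * b\<close> from Hoelder; similarly for \<open>H\<close>.\<close>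
    have "1 + r * b = r / q" "1 + r * c = r / p"
      using r by (auto simp: a_b_c_def field_simps)
    moreover have "t * t powr s = t powr (1 + s)" if "t \<ge> 0" for t s :: real
      using that by (cases "t = 0") (auto simp: powr_add)
    ultimately show ?thesis using B H by (metis mult.assoc mult.left_commute)
  qed
  finally show "(LINT x|M1. (LINT y|M2. K x y * h y) powr r)
      \<le> B powr (r / q) * (LINT y|M2. h y powr p) powr (r / p)" by (simp add: H_def)
qed

section \<open>The kernel of the Hartley-Fourier convolution\<close>

text \<open>
  The boundary case of an argument 0 is not covered by convexity of \<open>t powr q\<close> on the open
  half-line; it amounts to \<open>2 \<le> 2 powr q\<close>.
\<close>

lemma powr_midpoint_le:
  fixes x y q :: real
  assumes "q \<ge> 1" "x \<ge> 0" "y \<ge> 0"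
  shows "((x + y) / 2) powr q \<le> (x powr q + y powr q) / 2"
proof (cases "x = 0 \<or> y = 0")
  case True
  have "2 powr 1 \<le> (2::real) powr q" using assms by (intro powr_mono) auto
  then have "(t / 2) powr q \<le> t powr q / 2" if "t \<ge> 0" for t :: real
    using that frac_le[of "t powr q" "t powr q" 2 "2 powr q"] by (simp add: powr_divide)
  then show ?thesis using True assms by auto
next
  case False
  then show ?thesis
    using convex_onD[OF powr_convex[OF assms(1)], of "1/2" x y] assms
    by (auto simp: field_simps)
qed

text \<open>
  The factor \<open>4 powr q / 4\<close> is sharp for equal arguments. Summed over four integrals of equal value
  it yields exactly \<open>4 powr q\<close>, so the constant is the one obtained by adding four \<open>L\<^sub>q\<close> norms.
\<close>

lemma powr_sum4_le:
  fixes x1 x2 x3 x4 q :: real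
  assumes q: "q \<ge> 1" and nn: "x1 \<ge> 0" "x2 \<ge> 0" "x3 \<ge> 0" "x4 \<ge> 0"
  shows "(x1 + x2 + x3 + x4) powr q
          \<le> 4 powr q / 4 * (x1 powr q + x2 powr q + x3 powr q + x4 powr q)"
proof -
  have "(x1 + x2 + x3 + x4) powr q = (4 * (((x1 + x2) / 2 + (x3 + x4) / 2) / 2)) powr q"
    by (rule arg_cong[where f = "\<lambda>t. t powr q"]) (simp add: add_divide_distrib)
  also have "\<dots> = 4 powr q * (((x1 + x2) / 2 + (x3 + x4) / 2) / 2) powr q"
    by (rule powr_mult)
  also have "\<dots> \<le> 4 powr q * ((((x1 + x2) / 2) powr q + ((x3 + x4) / 2) powr q) / 2)"
    using q nn by (intro mult_left_mono powr_midpoint_le) auto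
  also have "\<dots> \<le> 4 powr q * (((x1 powr q + x2 powr q) / 2 + (x3 powr q + x4 powr q) / 2) / 2)"
    using q nn by (intro mult_left_mono divide_right_mono add_mono powr_midpoint_le) auto
  finally show ?thesis by (simp add: field_simps)
qed

lemma lborel_reflect_translate:
  fixes \<phi> :: "real \<Rightarrow> real"
  assumes "integrable lborel \<phi>"
  shows "integrable lborel (\<lambda>y. \<phi> (t + y))" "integrable lborel (\<lambda>y. \<phi> (t - y))"
    "(LINT y|lborel. \<phi> (t + y)) = (LINT y|lborel. \<phi> y)"
    "(LINT y|lborel. \<phi> (t - y)) = (LINT y|lborel. \<phi> y)"
proof -
  show "integrable lborel (\<lambda>y. \<phi> (t + y))" "integrable lborel (\<lambda>y. \<phi> (t - y))"
    using lborel_integrable_real_affine[OF assms, of 1 t]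
      lborel_integrable_real_affine[OF assms, of "-1" t] by simp_all
  show "(LINT y|lborel. \<phi> (t + y)) = (LINT y|lborel. \<phi> y)"
    using lborel_integral_real_affine[of 1 \<phi> t, symmetric] by simp
  show "(LINT y|lborel. \<phi> (t - y)) = (LINT y|lborel. \<phi> y)"
    using lborel_integral_real_affine[of "-1" \<phi> t, symmetric] by simp
qed

text \<open>
  The triangle-inequality bound for the bracket multiplying \<open>g y\<close> in the convolution.
\<close>

definition hf_kernel :: "(real \<Rightarrow> complex) \<Rightarrow> real \<Rightarrow> real \<Rightarrow> real" where
  "hf_kernel f x y = norm (f (x + y)) + norm (f (x - y)) + norm (f (- x - y)) + norm (f (- x + y))"

lemma hf_kernel_nonneg: "hf_kernel f x y \<ge> 0"
  by (simp add: hf_kernel_def)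

text \<open>
  Exchanging the variables permutes the four terms, so estimates of rows serve for columns as well.
\<close>

lemma hf_kernel_commute: "hf_kernel f x y = hf_kernel f y x"
proof -
  have "x + y = y + x" "x - y = - y + x" "- x - y = - y - x" "- x + y = y - x"
    by simp_all
  then have "norm (f (x + y)) = norm (f (y + x))" "norm (f (x - y)) = norm (f (- y + x))"
      "norm (f (- x - y)) = norm (f (- y - x))" "norm (f (- x + y)) = norm (f (y - x))"
    by (simp_all only:)
  then show ?thesis
    unfolding hf_kernel_def by linarith
qed

lemma norm_hf_integrand_le: "norm (hf_integrand f g x y) \<le> hf_kernel f x y * norm (g y)"
proof -
  have "norm (s + t + \<i> * u - \<i> * v) \<le> norm s + norm t + norm u + norm v" for s t u v :: complex
    using norm_triangle_ineq4[of "s + t + \<i> * u" "\<i> * v"]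
      norm_triangle_ineq[of "s + t" "\<i> * u"] norm_triangle_ineq[of s t]
    by (simp add: norm_mult)
  from mult_left_mono[OF this[of "f (x + y)" "f (x - y)" "f (- x - y)" "f (- x + y)"] norm_ge_zero[of "g y"]]
  show ?thesis
    unfolding hf_integrand_def hf_kernel_def norm_mult by (simp only: mult.commute)
qed

lemma hf_kernel_powr_section:
  assumes q: "q \<ge> 1" and [measurable]: "f \<in> borel_measurable borel"
    and int: "integrable lborel (\<lambda>x. norm (f x) powr q)"
  shows "integrable lborel (\<lambda>y. hf_kernel f x y powr q)"
    and "(LINT y|lborel. hf_kernel f x y powr q) \<le> 4 powr q * (LINT x|lborel. norm (f x) powr q)"
proof -
  note shift = lborel_reflect_translate[OF int]
  define b where "b y = 4 powr q / 4 * (norm (f (x + y)) powr q + norm (f (x - y)) powr q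
      + norm (f (- x - y)) powr q + norm (f (- x + y)) powr q)" for y
  have le: "hf_kernel f x y powr q \<le> b y" for y
    unfolding hf_kernel_def b_def using q by (intro powr_sum4_le) auto
  have b_int: "integrable lborel b"
    unfolding b_def by (intro integrable_mult_right Bochner_Integration.integrable_add shift)
  have [measurable]: "(\<lambda>y. hf_kernel f x y) \<in> borel_measurable borel"
    unfolding hf_kernel_def by measurable
  show k_int: "integrable lborel (\<lambda>y. hf_kernel f x y powr q)"
    by (rule Bochner_Integration.integrable_bound[OF b_int])
       (use le in \<open>auto intro!: AE_I2 intro: order_trans[OF _ abs_ge_self]\<close>)
  have "(LINT y|lborel. hf_kernel f x y powr q) \<le> (LINT y|lborel. b y)"
    by (intro integral_mono k_int b_int le)
  also have "\<dots> = 4 powr q / 4 * (LINT y|lborel. norm (f (x + y)) powr q + norm (f (x - y)) powr q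
      + norm (f (- x - y)) powr q + norm (f (- x + y)) powr q)"
    unfolding b_def by (rule integral_mult_right_zero)
  also have "\<dots> = 4 powr q / 4 * ((LINT y|lborel. norm (f (x + y)) powr q)
      + (LINT y|lborel. norm (f (x - y)) powr q) + (LINT y|lborel. norm (f (- x - y)) powr q)
      + (LINT y|lborel. norm (f (- x + y)) powr q))"
    by (intro arg_cong2[where f = "(*)"] refl)
       (simp only: Bochner_Integration.integral_add Bochner_Integration.integrable_add shift(1,2))
  also have "\<dots> = 4 powr q * (LINT x|lborel. norm (f x) powr q)"
    unfolding shift(3,4) by simp
  finally show "(LINT y|lborel. hf_kernel f x y powr q) \<le> 4 powr q * (LINT x|lborel. norm (f x) powr q)" .
qed

section \<open>Borel representatives\<close>

lemma lebesgue_eq_borel_AE: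
  fixes f :: "real \<Rightarrow> complex"
  assumes f: "f \<in> borel_measurable lebesgue"
  obtains f' where "f' \<in> borel_measurable borel" "AE x in lborel. f x = f' x"
proof -
  have "(\<lambda>x. Re (f x)) \<in> borel_measurable lebesgue" "(\<lambda>x. Im (f x)) \<in> borel_measurable lebesgue"
    using f by measurable
  from this[THEN completion_ex_borel_measurable_real]
  obtain u v where [measurable]: "u \<in> borel_measurable lborel" "v \<in> borel_measurable lborel"
    and ae: "AE x in lborel. Re (f x) = u x" "AE x in lborel. Im (f x) = v x"
    by blast
  show thesis
  proof
    have "(\<lambda>x. Complex (u x) (v x)) = (\<lambda>x. complex_of_real (u x) + \<i> * complex_of_real (v x))"
      by (simp add: fun_eq_iff complex_eq_iff)
    also have "\<dots> \<in> borel_measurable borel" by measurable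
    finally show "(\<lambda>x. Complex (u x) (v x)) \<in> borel_measurable borel" .
    show "AE x in lborel. f x = Complex (u x) (v x)"
      using ae by eventually_elim (simp add: complex_eq_iff)
  qed
qed

text \<open>
  Stated for arbitrary predicates: equality with a merely Lebesgue measurable function need not be
  a Borel measurable condition, so the exceptional set is first enlarged to a Borel null set.
\<close>

lemma AE_lborel_affine:
  fixes P :: "real \<Rightarrow> bool"
  assumes c: "c \<noteq> 0" and ae: "AE x in lborel. P x"
  shows "AE x in lborel. P (t + c * x)"
proof -
  obtain N where N: "{x. \<not> P x} \<subseteq> N" "N \<in> null_sets lborel"
    using ae by (auto simp: eventually_ae_filter)
  then have [measurable]: "N \<in> sets borel" by auto
  have "AE x in lborel. t + c * x \<notin> N"
    using AE_borel_affine[OF c, of "\<lambda>x. x \<notin> N" t] AE_not_in[OF N(2)] by simp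
  then show ?thesis using N(1) by (auto elim!: eventually_mono)
qed

lemma integral_lebesgue_AE_borel:
  fixes f g :: "real \<Rightarrow> 'a :: euclidean_space"
  assumes [measurable]: "g \<in> borel_measurable borel" and ae: "AE x in lborel. f x = g x"
  shows "integrable lebesgue f \<longleftrightarrow> integrable lborel g"
    and "integral\<^sup>L lebesgue f = integral\<^sup>L lborel g"
proof -
  have g: "g \<in> borel_measurable lebesgue" by (simp add: measurable_completion)
  have ae': "AE x in lebesgue. f x = g x"
    using ae by (rule AE_completion)
  have f: "f \<in> borel_measurable lebesgue"
    by (rule borel_measurable_AE[OF g]) (use ae' in \<open>auto elim!: eventually_mono\<close>)
  show "integrable lebesgue f \<longleftrightarrow> integrable lborel g"
    using integrable_cong_AE[OF f g ae'] integrable_completion[of g lborel] by simp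
  show "integral\<^sup>L lebesgue f = integral\<^sup>L lborel g"
    using integral_cong_AE[OF f g ae'] integral_completion[of g lborel] by simp
qed

text \<open>
  Valid for every \<open>x\<close> and not just for almost every \<open>x\<close>, so the convolution itself does not
  change under passage to representatives.
\<close>

lemma hf_integrand_AE_cong:
  assumes f: "AE x in lborel. f x = f' x" and g: "AE x in lborel. g x = g' x"
  shows "AE y in lborel. hf_integrand f g x y = hf_integrand f' g' x y"
proof -
  have "AE y in lborel. f (x + 1 * y) = f' (x + 1 * y)" "AE y in lborel. f (x + - 1 * y) = f' (x + - 1 * y)"
    "AE y in lborel. f (- x + - 1 * y) = f' (- x + - 1 * y)" "AE y in lborel. f (- x + 1 * y) = f' (- x + 1 * y)"
    by (rule AE_lborel_affine[OF _ f]; simp)+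
  then show ?thesis
    using g by eventually_elim (simp add: hf_integrand_def)
qed

section \<open>Young's inequality for the convolution\<close>

lemma hf_young_borel:
  fixes p q r :: real and f g :: "real \<Rightarrow> complex"
  assumes p: "p > 1" and q: "q > 1" and r: "r > 1" and pqr: "1 / p + 1 / q = 1 + 1 / r"
    and meas [measurable]: "f \<in> borel_measurable borel" "g \<in> borel_measurable borel"
    and f: "integrable lborel (\<lambda>x. norm (f x) powr q)" and g: "integrable lborel (\<lambda>x. norm (g x) powr p)"
  defines "c \<equiv> 1 / (2 * sqrt (2 * pi))"
  defines "h \<equiv> \<lambda>x. complex_of_real c * (LINT y|lborel. hf_integrand f g x y)"
  shows "AE x in lborel. integrable lborel (hf_integrand f g x)"
    and "h \<in> borel_measurable borel"
    and "integrable lborel (\<lambda>x. norm (h x) powr r)"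
    and "(LINT x|lborel. norm (h x) powr r) powr (1 / r)
      \<le> sqrt (2 / pi) * (LINT x|lborel. norm (g x) powr p) powr (1 / p)
          * (LINT x|lborel. norm (f x) powr q) powr (1 / q)"
proof -
  define F where "F = (LINT x|lborel. norm (f x) powr q)"
  define G where "G = (LINT x|lborel. norm (g x) powr p)"
  define T where "T x = (LINT y|lborel. hf_kernel f x y * norm (g y))" for x
  have FG: "F \<ge> 0" "G \<ge> 0" by (simp_all add: F_def G_def)
  have c: "c > 0" by (simp add: c_def)
  have K_meas [measurable]: "case_prod (hf_kernel f) \<in> borel_measurable (lborel \<Otimes>\<^sub>M lborel)"
    unfolding hf_kernel_def by measurable
  note sec = hf_kernel_powr_section[OF less_imp_le[OF q] meas(1) f]
  note young = lborel_pair.Young_kernel[where K = "hf_kernel f" and h = "\<lambda>y. norm (g y)"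
      and B = "4 powr q * F", OF p q r pqr K_meas]
  have T_AE: "AE x in lborel. integrable lborel (\<lambda>y. hf_kernel f x y * norm (g y))"
    by (rule young) (use sec g hf_kernel_nonneg in \<open>simp_all add: F_def hf_kernel_commute[of f _ y for y]\<close>)
  have T_int: "integrable lborel (\<lambda>x. T x powr r)"
    unfolding T_def
    by (rule young) (use sec g hf_kernel_nonneg in \<open>simp_all add: F_def hf_kernel_commute[of f _ y for y]\<close>)
  have T_le: "(LINT x|lborel. T x powr r) \<le> (4 powr q * F) powr (r / q) * G powr (r / p)"
    unfolding T_def G_def
    by (rule young) (use sec g hf_kernel_nonneg in \<open>simp_all add: F_def hf_kernel_commute[of f _ y for y]\<close>)
  have I_meas [measurable]: "case_prod (hf_integrand f g) \<in> borel_measurable (lborel \<Otimes>\<^sub>M lborel)"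
    unfolding hf_integrand_def by measurable
  show h_meas [measurable]: "h \<in> borel_measurable borel"
  proof -
    have "h \<in> borel_measurable lborel" unfolding h_def by measurable
    then show ?thesis by simp
  qed
  have AE: "AE x in lborel. integrable lborel (hf_integrand f g x) \<and> norm (h x) \<le> c * T x"
    using T_AE
  proof eventually_elim
    case (elim x)
    have int: "integrable lborel (hf_integrand f g x)"
      by (rule Bochner_Integration.integrable_bound[OF elim])
         (auto intro!: AE_I2 order_trans[OF norm_hf_integrand_le])
    have "norm (h x) = c * norm (LINT y|lborel. hf_integrand f g x y)"
      using c by (simp add: h_def norm_mult)
    also have "\<dots> \<le> c * T x"
    proof (intro mult_left_mono)
      have "norm (LINT y|lborel. hf_integrand f g x y) \<le> (LINT y|lborel. norm (hf_integrand f g x y))"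
        by (rule integral_norm_bound)
      also have "\<dots> \<le> T x"
        unfolding T_def by (intro integral_mono integrable_norm int elim norm_hf_integrand_le)
      finally show "norm (LINT y|lborel. hf_integrand f g x y) \<le> T x" .
    qed (use c in simp)
    finally show ?case using int by simp
  qed
  then show "AE x in lborel. integrable lborel (hf_integrand f g x)" by auto
  have T_nonneg: "T x \<ge> 0" for x by (simp add: T_def hf_kernel_nonneg)
  have AE_powr: "AE x in lborel. norm (h x) powr r \<le> c powr r * T x powr r"
    using AE
  proof eventually_elim
    case (elim x)
    then have "norm (h x) powr r \<le> (c * T x) powr r"
      using r by (intro powr_mono2) auto
    then show ?case using c T_nonneg by (simp add: powr_mult)
  qed
  have bound_int: "integrable lborel (\<lambda>x. c powr r * T x powr r)"
    using T_int by simp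
  show h_int: "integrable lborel (\<lambda>x. norm (h x) powr r)"
    by (rule Bochner_Integration.integrable_bound[OF bound_int])
       (use AE_powr in auto)
  have "(LINT x|lborel. norm (h x) powr r) \<le> (LINT x|lborel. c powr r * T x powr r)"
    by (rule integral_mono_AE[OF h_int bound_int AE_powr])
  also have "\<dots> \<le> c powr r * ((4 powr q * F) powr (r / q) * G powr (r / p))"
    using T_le by (simp add: mult_left_mono)
  finally have "(LINT x|lborel. norm (h x) powr r) powr (1 / r)
      \<le> (c powr r * ((4 powr q * F) powr (r / q) * G powr (r / p))) powr (1 / r)"
    using r by (intro powr_mono2) auto
  also have "\<dots> = (4 * c) * G powr (1 / p) * F powr (1 / q)"
    using p q r c FG by (simp add: powr_mult powr_powr)
  also have "4 * c = sqrt (2 / pi)"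
  proof -
    have "sqrt (2 / pi) = sqrt (4 / (2 * pi))" by simp
    also have "\<dots> = 2 / sqrt (2 * pi)" by (simp only: real_sqrt_divide real_sqrt_four)
    finally show ?thesis by (simp add: c_def)
  qed
  finally show "(LINT x|lborel. norm (h x) powr r) powr (1 / r)
      \<le> sqrt (2 / pi) * (LINT x|lborel. norm (g x) powr p) powr (1 / p)
          * (LINT x|lborel. norm (f x) powr q) powr (1 / q)"
    by (simp add: F_def G_def)
qed

lemma Lp_borel_representative:
  assumes "f \<in> Lp_space s"
  obtains f' where "f' \<in> borel_measurable borel" "AE x in lborel. f x = f' x"
    "integrable lborel (\<lambda>x. norm (f' x) powr s)"
    "Lp_norm s f = (LINT x|lborel. norm (f' x) powr s) powr (1 / s)"
proof -
  have f: "f \<in> borel_measurable lebesgue" "integrable lebesgue (\<lambda>x. norm (f x) powr s)"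
    using assms by (auto simp: Lp_space_def)
  obtain f' where [measurable]: "f' \<in> borel_measurable borel" and ae: "AE x in lborel. f x = f' x"
    using lebesgue_eq_borel_AE[OF f(1)] by blast
  have "AE x in lborel. norm (f x) powr s = norm (f' x) powr s"
    using ae by eventually_elim simp
  note eq = integral_lebesgue_AE_borel[OF _ this]
  show thesis
    by (rule that[of f']) (use f ae eq in \<open>auto simp: Lp_norm_def\<close>)
qed

theorem corollary3p1:
  fixes p q r :: real and f g :: "real \<Rightarrow> complex"
  assumes "p > 1" and "q > 1" and "r > 1"
    and "1 / p + 1 / q = 1 + 1 / r"
    and "g \<in> Lp_space p" and "f \<in> Lp_space q"
  shows "hf_conv_exists f g \<and>
         hf_conv f g \<in> Lp_space r \<and>
         Lp_norm r (hf_conv f g) \<le> sqrt (2 / pi) * Lp_norm p g * Lp_norm q f"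
proof -
  obtain g' where g': "g' \<in> borel_measurable borel" "AE x in lborel. g x = g' x"
      "integrable lborel (\<lambda>x. norm (g' x) powr p)"
      "Lp_norm p g = (LINT x|lborel. norm (g' x) powr p) powr (1 / p)"
    using Lp_borel_representative[OF assms(5)] .
  obtain f' where f': "f' \<in> borel_measurable borel" "AE x in lborel. f x = f' x"
      "integrable lborel (\<lambda>x. norm (f' x) powr q)"
      "Lp_norm q f = (LINT x|lborel. norm (f' x) powr q) powr (1 / q)"
    using Lp_borel_representative[OF assms(6)] .
  note young = hf_young_borel[OF assms(1-4) f'(1) g'(1) f'(3) g'(3)]
  have "hf_integrand f' g' x \<in> borel_measurable borel" for x
    using f'(1) g'(1) unfolding hf_integrand_def by measurable
  note eq = integral_lebesgue_AE_borel[OF this hf_integrand_AE_cong[OF f'(2) g'(2)]]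
  have conv: "complex_of_real (1 / (2 * sqrt (2 * pi))) * (LINT y|lborel. hf_integrand f' g' x y)
      = hf_conv f g x" for x
    by (simp only: hf_conv_def eq)
  note young = young[unfolded conv]
  note [measurable] = young(2)
  have "hf_conv_exists f g"
    unfolding hf_conv_exists_def eq by (rule AE_completion[OF young(1)])
  moreover have "hf_conv f g \<in> Lp_space r"
    using young(3) by (simp add: Lp_space_def integrable_completion measurable_completion)
  moreover have "Lp_norm r (hf_conv f g) \<le> sqrt (2 / pi) * Lp_norm p g * Lp_norm q f"
    using young(4)[folded f'(4) g'(4)] by (simp add: Lp_norm_def integral_completion)
  ultimately show ?thesis by blast
qed

end
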